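(* Let $g\in W_0$ have stable integer shifts, and let $k\in\mathbb{N}$. (i) If $g$ is odd, then for every choice of points $0<x_1<\dots<x_{\lfloor k/2\rfloor}<\lfloor k/2\rfloor$ the set $\Lambda_k=\left(F_{\lfloor k/2\rfloor}\cup\{0,\tfrac{k}{2}\}\right)+k\mathbb{Z}$ is not a uniqueness set for $V^\infty(g)$. (ii) Assume that $g$ is even. If $k$ is odd, then for every choice of points $0<x_1<\dots<x_{(k-1)/2}<(k-1)/2$ the set $\Gamma_k=\left(F_{(k-1)/2}\cup\{\tfrac{k}{2}\}\right)+k\mathbb{Z}$ is not a uniqueness set for $V^\infty(g)$. If $k$ is even, then for every choice of points $0<x_1<\dots<x_{k/2}<k/2$ the set $\Theta_k=F_{k/2}+k\mathbb{Z}$ is not a uniqueness set for $V^\infty(g)$.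
   Context: $\mathbb{N}=\{1,2,\dots\}$; $\lfloor s\rfloor$ is the greatest integer $\le s$. For sets $A,B\subset\mathbb{R}$, $A+B=\{a+b:a\in A,b\in B\}$. $W_0$ is the set of continuous functions $g:\mathbb{R}\to\mathbb{C}$ with $\sum_{m\in\mathbb{Z}}\|g\|_{L^\infty(m,m+1)}<\infty$. For $g\in W_0$ and $1\le p\le\infty$, the shift-invariant space is $V^p(g)=\{f(x)=\sum_{n\in\mathbb{Z}}c_n g(x-n):\{c_n\}\in\ell^p(\mathbb{Z})\}$. The function $g$ has stable integer shifts if for every $p\in[1,\infty]$ there are constants $A,B>0$ such that $A\|\{c_n\}\|_{\ell^p}\le\|\sum_n c_n g(\cdot-n)\|_{L^p(\mathbb{R})}\le B\|\{c_n\}\|_{\ell^p}$ for all $\{c_n\}\in\ell^p(\mathbb{Z})$. A set $\Lambda\subset\mathbb{R}$ is a uniqueness set for $V^p(g)$ if every $f\in V^p(g)$ with $f(\lambda)=0$ for all $\lambda\in\Lambda$ satisfies $f\equiv0$. For $n\in\mathbb{N}$ and points $0<x_1<\dots<x_n<n$, $F_n=F_n(x_1,\dots,x_n)=\{\pm x_1,\dots,\pm x_n\}$; $F_0=\emptyset$. $g$ is odd if $g(-x)=-g(x)$ and even if $g(-x)=g(x)$ for all $x\in\mathbb{R}$. *)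

theory Defs
  imports "HOL-Analysis.Analysis" "HOL-Probability.Essential_Supremum"
begin

text \<open>
  The \<open>L\<^sup>p(M)\<close> norm for \<open>1 \<le> p \<le> \<infinity>\<close>, with value \<open>\<infinity>\<close> for measurable functions outside \<open>L\<^sup>p(M)\<close>.
  The exponent and the value lie in \<^typ>\<open>ennreal\<close>, which has no \<open>powr\<close>; this is why an infinite
  integral is treated separately.
\<close>

definition Lp_norm :: "ennreal \<Rightarrow> 'a measure \<Rightarrow> ('a \<Rightarrow> complex) \<Rightarrow> ennreal" where
  "Lp_norm p M f =
     (if p = \<infinity> then esssup M (\<lambda>x. ennreal (norm (f x)))
      else let I = (\<integral>\<^sup>+ x. ennreal (norm (f x) powr enn2real p) \<partial>M)
           in if I = \<infinity> then \<infinity> else ennreal (enn2real I powr (1 / enn2real p)))"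

abbreviation lp_norm :: "ennreal \<Rightarrow> (int \<Rightarrow> complex) \<Rightarrow> ennreal" where
  "lp_norm p c \<equiv> Lp_norm p (count_space UNIV) c"

definition lp_space :: "ennreal \<Rightarrow> (int \<Rightarrow> complex) set" where
  "lp_space p = {c. lp_norm p c < \<infinity>}"

text \<open>
  In \<^typ>\<open>ennreal\<close> every family is summable, so finiteness of the sum expresses convergence.
\<close>

definition W0 :: "(real \<Rightarrow> complex) set" where
  "W0 = {g. continuous_on UNIV g \<and>
            (\<Sum>\<^sub>\<infinity>m::int. Lp_norm \<infinity> (restrict_space lborel {of_int m<..<of_int m + 1}) g) < \<infinity>}"

text \<open>
  For \<open>g\<close> in \<^const>\<open>W0\<close> and bounded \<open>c\<close> this series converges absolutely at every point, so the
  unordered sum is the pointwise bi-infinite series.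
\<close>

definition shift_series :: "(real \<Rightarrow> complex) \<Rightarrow> (int \<Rightarrow> complex) \<Rightarrow> real \<Rightarrow> complex" where
  "shift_series g c x = (\<Sum>\<^sub>\<infinity>n. c n * g (x - of_int n))"

definition shift_invariant_space :: "ennreal \<Rightarrow> (real \<Rightarrow> complex) \<Rightarrow> (real \<Rightarrow> complex) set" where
  "shift_invariant_space p g = shift_series g ` lp_space p"

definition stable_integer_shifts :: "(real \<Rightarrow> complex) \<Rightarrow> bool" where
  "stable_integer_shifts g \<longleftrightarrow>
     (\<forall>p\<ge>1. \<exists>A B :: real. A > 0 \<and> B > 0 \<and>
        (\<forall>c\<in>lp_space p.
           ennreal A * lp_norm p c \<le> Lp_norm p lborel (shift_series g c) \<and>
           Lp_norm p lborel (shift_series g c) \<le> ennreal B * lp_norm p c))"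

definition uniqueness_set :: "real set \<Rightarrow> (real \<Rightarrow> complex) set \<Rightarrow> bool" where
  "uniqueness_set \<Lambda> V \<longleftrightarrow> (\<forall>f\<in>V. (\<forall>l\<in>\<Lambda>. f l = 0) \<longrightarrow> (\<forall>x. f x = 0))"

text \<open>
  A tuple \<open>(x\<^sub>1, \<dots>, x\<^sub>n)\<close> is a function of which only the values on \<open>{1..n}\<close> matter.
  For \<open>n = 0\<close> the condition below is vacuous and \<open>F_set 0 x\<close> is empty.
\<close>

definition admissible_points :: "nat \<Rightarrow> (nat \<Rightarrow> real) \<Rightarrow> bool" where
  "admissible_points n x \<longleftrightarrow>
     strict_mono_on {1..n} x \<and> (\<forall>i\<in>{1..n}. 0 < x i \<and> x i < real n)"

definition F_set :: "nat \<Rightarrow> (nat \<Rightarrow> real) \<Rightarrow> real set" where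
  "F_set n x = (\<Union>i\<in>{1..n}. {x i, - x i})"

text \<open>Sums of sets below are the elementwise sums of \<^theory>\<open>HOL-Library.Set_Algebras\<close>.\<close>

definition multiples :: "nat \<Rightarrow> real set" where
  "multiples k = (\<lambda>j. real k * j) ` \<int>"

definition Lambda_set :: "nat \<Rightarrow> (nat \<Rightarrow> real) \<Rightarrow> real set" where
  "Lambda_set k x = (F_set (k div 2) x \<union> {0, real k / 2}) + multiples k"

definition Gamma_set :: "nat \<Rightarrow> (nat \<Rightarrow> real) \<Rightarrow> real set" where
  "Gamma_set k x = (F_set ((k - 1) div 2) x \<union> {real k / 2}) + multiples k"

definition Theta_set :: "nat \<Rightarrow> (nat \<Rightarrow> real) \<Rightarrow> real set" where
  "Theta_set k x = F_set (k div 2) x + multiples k"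

end

theory Submission
  imports Defs
begin

text \<open>
  If the coefficients satisfy \<open>c (n + k) = t * c n\<close> with \<open>t = 1\<close> or \<open>t = -1\<close> and
  \<open>c (- n) = c n\<close>, then \<open>f = shift_series g c\<close> satisfies \<open>f (x + k) = t * f x\<close> and inherits the
  parity of \<open>g\<close>. By these two symmetries the zeros of \<open>f\<close> are invariant under \<open>x \<mapsto> - x\<close> and
  under translation by \<open>k\<close>, so \<open>f\<close> vanishes on the whole orbit of a point as soon as it vanishes
  at that point. Some zeros come for free: an odd \<open>f\<close> vanishes at \<open>0\<close>, and
  \<open>f (k/2) = t * f (- k/2)\<close> is zero whenever the parity sign \<open>s\<close> of \<open>g\<close> and \<open>t\<close> satisfy
  \<open>s * t = -1\<close> (lemma \<open>half_period_zero\<close>).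

  It remains to make \<open>f\<close> vanish at the points \<open>x\<^sub>1, \<dots>, x\<^sub>m\<close>, where \<open>m = \<lfloor>k/2\<rfloor>\<close>. The coefficient
  sequences with the two symmetries form a space of dimension \<open>m + 1\<close>, provided that \<open>t = 1\<close>
  when \<open>k\<close> is even: their values at \<open>0, \<dots>, m\<close> are arbitrary and determine the rest.
  Hence \<open>m\<close> homogeneous linear conditions leave a nonzero sequence \<open>c\<close>, and the lower stability
  bound for \<open>p = \<infinity>\<close> shows that \<open>f\<close> is not identically zero.

  For odd \<open>g\<close> one takes periodic coefficients, \<open>t = 1\<close>, which gives the zeros \<open>0\<close> and \<open>k/2\<close>.
  For even \<open>g\<close> and even \<open>k\<close> one also takes \<open>t = 1\<close>. For even \<open>g\<close> and odd \<open>k\<close> the periodic even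
  sequences have one dimension too few, since \<open>k/2\<close> would be an additional condition; antiperiodic
  ones, \<open>t = -1\<close>, have the same dimension and give the zero at \<open>k/2\<close> for free.
\<close>

section \<open>Homogeneous linear systems\<close>

text \<open>
  Gaussian elimination: if some unknown \<open>p\<close> occurs in the equation \<open>i\<close>, eliminate \<open>p\<close> from the other
  equations, solve these in the remaining unknowns, and read off \<open>a p\<close> from equation \<open>i\<close>.
\<close>

lemma underdetermined_homogeneous_system:
  fixes M :: "'i \<Rightarrow> 'j \<Rightarrow> 'a :: field"
  assumes "finite I" "finite J" "card I < card J"
  shows "\<exists>a. (\<exists>j\<in>J. a j \<noteq> 0) \<and> (\<forall>i\<in>I. (\<Sum>j\<in>J. a j * M i j) = 0)"
  using assms
proof (induction I arbitrary: J M rule: finite_induct)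
  case empty
  then have "J \<noteq> {}" by auto
  then show ?case by (intro exI[of _ "\<lambda>_. 1"]) auto
next
  case (insert i I)
  show ?case
  proof (cases "\<forall>j\<in>J. M i j = 0")
    case True
    have "card I < card J" using insert by simp
    then obtain a where "\<exists>j\<in>J. a j \<noteq> 0" "\<forall>i\<in>I. (\<Sum>j\<in>J. a j * M i j) = 0"
      using insert.IH[of J M] insert.prems by blast
    with True show ?thesis by (intro exI[of _ a]) simp
  next
    case False
    then obtain p where p: "p \<in> J" "M i p \<noteq> 0" by blast
    define J' where "J' = J - {p}"
    have J': "finite J'" "p \<notin> J'" "J = insert p J'" "card I < card J'"
      using insert p by (auto simp: J'_def)
    define N where "N i' j = M i' j - M i' p * M i j / M i p" for i' j
    obtain a where a: "\<exists>j\<in>J'. a j \<noteq> 0" "\<forall>i\<in>I. (\<Sum>j\<in>J'. a j * N i j) = 0"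
      using insert.IH[of J' N] J' by blast
    define t where "t = - (\<Sum>j\<in>J'. a j * M i j) / M i p"
    define b where "b = a(p := t)"
    have split: "(\<Sum>j\<in>J. b j * M i' j) = t * M i' p + (\<Sum>j\<in>J'. a j * M i' j)" for i'
    proof -
      have "(\<Sum>j\<in>J'. b j * M i' j) = (\<Sum>j\<in>J'. a j * M i' j)"
        using J'(2) by (intro sum.cong) (auto simp: b_def)
      then show ?thesis using J' by (simp add: b_def)
    qed
    have row: "(\<Sum>j\<in>J. b j * M i' j) = (\<Sum>j\<in>J'. a j * N i' j)" for i'
    proof -
      have "(\<Sum>j\<in>J'. a j * N i' j)
          = (\<Sum>j\<in>J'. a j * M i' j - (M i' p / M i p) * (a j * M i j))"
        by (intro sum.cong) (auto simp: N_def algebra_simps)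
      also have "\<dots> = (\<Sum>j\<in>J'. a j * M i' j) - (M i' p / M i p) * (\<Sum>j\<in>J'. a j * M i j)"
        by (simp only: sum_subtractf sum_distrib_left)
      finally show ?thesis unfolding split t_def by simp
    qed
    have "(\<Sum>j\<in>J. b j * M i j) = 0" unfolding split t_def using p by simp
    moreover have "\<exists>j\<in>J. b j \<noteq> 0" using a(1) J' by (auto simp: b_def)
    ultimately show ?thesis using row a(2) by (intro exI[of _ b]) simp
  qed
qed

section \<open>Convergence and linearity of shift series\<close>

text \<open>
  For a continuous function the essential supremum over an open interval bounds every value on the
  closed interval: the set where the bound holds is closed and has full measure, hence contains
  the open interval and its closure. The endpoints matter because \<open>x - n\<close> may be an integer.
\<close>

lemma norm_le_Linf_norm:
  fixes g :: "real \<Rightarrow> complex" and a b y :: real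
  assumes "continuous_on UNIV g" "a < b" "y \<in> {a..b}"
  shows "ennreal (norm (g y)) \<le> Lp_norm \<infinity> (restrict_space lborel {a<..<b}) g"
proof -
  define L where "L = Lp_norm \<infinity> (restrict_space lborel {a<..<b}) g"
  define C where "C = {x. ennreal (norm (g x)) \<le> L}"
  have "closed C"
    unfolding C_def using assms(1)
    by (intro closed_Collect_le continuous_intros continuous_on_ennreal) auto
  have "AE x in restrict_space lborel {a<..<b}. ennreal (norm (g x)) \<le> L"
    unfolding L_def Lp_norm_def using esssup_AE by simp
  then have "AE x\<in>{a<..<b} in lborel. x \<in> C"
    by (subst (asm) AE_restrict_space_iff) (simp_all add: C_def)
  then have "AE x\<in>{a<..<b} in lebesgue. x \<in> C"
    by (rule AE_completion)
  then have "x \<in> C" if "x \<in> {a<..<b}" for x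
    using mem_closed_if_AE_lebesgue_open[of "{a<..<b}" C x] \<open>closed C\<close> that by auto
  then have "closure {a<..<b} \<subseteq> C"
    using \<open>closed C\<close> by (intro closure_minimal) auto
  then show ?thesis
    using assms(2,3) by (auto simp: C_def L_def)
qed

text \<open>
  The points \<open>x - n\<close> lie in the closures of pairwise distinct unit intervals among those that define
  \<^const>\<open>W0\<close>, so the sum of the absolute values is at most the sum of the sup norms.
\<close>

lemma W0_integer_shifts_norm_summable:
  assumes "g \<in> W0"
  shows "(\<lambda>n::int. norm (g (x - of_int n))) summable_on UNIV"
proof (rule nonneg_bdd_above_summable_on)
  define L where "L m = Lp_norm \<infinity> (restrict_space lborel {of_int m<..<of_int m + 1}) g" for m :: int
  define S where "S = (\<Sum>\<^sub>\<infinity>m. L m)"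
  have cont: "continuous_on UNIV g" and fin: "S < \<infinity>"
    using assms by (auto simp: W0_def S_def L_def)
  show "bdd_above (sum (\<lambda>n::int. norm (g (x - of_int n))) ` {F. F \<subseteq> UNIV \<and> finite F})"
  proof (rule bdd_aboveI2)
    fix F :: "int set" assume "F \<in> {F. F \<subseteq> UNIV \<and> finite F}"
    then have F: "finite F" by simp
    have "ennreal (\<Sum>n\<in>F. norm (g (x - of_int n))) = (\<Sum>n\<in>F. ennreal (norm (g (x - of_int n))))"
      by simp
    also have "\<dots> \<le> (\<Sum>n\<in>F. L (\<lfloor>x\<rfloor> - n))"
    proof (intro sum_mono)
      fix n
      have "x - of_int n \<in> {of_int (\<lfloor>x\<rfloor> - n)..of_int (\<lfloor>x\<rfloor> - n) + 1}"
        by (auto simp: algebra_simps; linarith)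
      then show "ennreal (norm (g (x - of_int n))) \<le> L (\<lfloor>x\<rfloor> - n)"
        unfolding L_def by (intro norm_le_Linf_norm cont) simp_all
    qed
    also have "\<dots> = sum L ((\<lambda>n. \<lfloor>x\<rfloor> - n) ` F)"
      by (subst sum.reindex) (auto simp: inj_on_def)
    also have "\<dots> \<le> S"
      unfolding S_def using F by (subst nonneg_infsum_complete) (auto intro!: SUP_upper)
    finally have "enn2real (ennreal (\<Sum>n\<in>F. norm (g (x - of_int n)))) \<le> enn2real S"
      using fin by (intro enn2real_mono) auto
    then show "(\<Sum>n\<in>F. norm (g (x - of_int n))) \<le> enn2real S"
      by (simp add: sum_nonneg)
  qed
qed auto

lemma shift_series_summable:
  assumes "g \<in> W0" and "\<And>n. norm (c n) \<le> B"
  shows "(\<lambda>n. c n * g (x - of_int n)) summable_on UNIV"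
proof (rule abs_summable_summable, rule Infinite_Sum.abs_summable_on_comparison_test')
  show "(\<lambda>n::int. B * norm (g (x - of_int n))) summable_on UNIV"
    using W0_integer_shifts_norm_summable[OF assms(1)] by (rule summable_on_cmult_right)
  show "norm (c n * g (x - of_int n)) \<le> B * norm (g (x - of_int n))" for n
    using assms(2)[of n] by (simp add: norm_mult mult_right_mono)
qed

lemma shift_series_linear_combination:
  assumes "g \<in> W0" "finite J" and bdd: "\<And>j n. norm (e j n) \<le> B"
  shows "shift_series g (\<lambda>n. \<Sum>j\<in>J. a j * e j n) x = (\<Sum>j\<in>J. a j * shift_series g (e j) x)"
proof -
  have summand: "((\<lambda>n. a j * (e j n * g (x - of_int n))) has_sum
               a j * shift_series g (e j) x) UNIV" for j
    unfolding shift_series_def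
    by (intro has_sum_cmult_right has_sum_infsum shift_series_summable[OF assms(1) bdd])
  have "((\<lambda>n. \<Sum>j\<in>J. a j * (e j n * g (x - of_int n))) has_sum
         (\<Sum>j\<in>J. a j * shift_series g (e j) x)) UNIV"
    using assms(2) by (induction J rule: finite_induct) (simp_all add: summand has_sum_add)
  then show ?thesis
    unfolding shift_series_def by (auto dest!: infsumI simp: sum_distrib_right mult.assoc)
qed

section \<open>Symmetries of shift series\<close>

lemma shift_series_quasi_periodic:
  assumes "\<And>n. c (n + p) = t * c n"
  shows "shift_series g c (x + of_int p) = t * shift_series g c x"
proof -
  have "shift_series g c (x + of_int p) = (\<Sum>\<^sub>\<infinity>n. t * (c n * g (x - of_int n)))"
    unfolding shift_series_def
    by (rule infsum_reindex_bij_witness[where i = "\<lambda>n. n + p" and j = "\<lambda>n. n - p"])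
       (use assms in \<open>auto simp: algebra_simps\<close>,
        metis add.commute assms diff_add_cancel mult.assoc mult.commute)
  then show ?thesis by (simp add: infsum_cmult_right' shift_series_def)
qed

lemma shift_series_reflect:
  assumes "\<And>n. c (- n) = c n" and "\<And>x. g (- x) = s * g x"
  shows "shift_series g c (- x) = s * shift_series g c x"
proof -
  have "shift_series g c (- x) = (\<Sum>\<^sub>\<infinity>n. s * (c n * g (x - of_int n)))"
    unfolding shift_series_def
  proof (rule infsum_reindex_bij_witness[where i = uminus and j = uminus])
    fix n :: int
    have "g (- x - of_int n) = s * g (x - of_int (- n))"
      using assms(2)[of "x + of_int n"] by simp
    then show "s * (c (- n) * g (x - of_int (- n))) = c n * g (- x - of_int n)"
      using assms(1) by (simp add: mult_ac)
  qed auto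
  then show ?thesis by (simp add: infsum_cmult_right' shift_series_def)
qed

lemma half_period_zero:
  fixes f :: "real \<Rightarrow> complex"
  assumes "\<And>y. f (y + real k) = t * f y" "\<And>y. f (- y) = s * f y" "s * t = - 1"
  shows "f (real k / 2) = 0"
proof -
  have "f (real k / 2) = t * f (- (real k / 2))"
    using assms(1)[of "- (real k / 2)"] by (simp add: field_simps)
  also have "\<dots> = (s * t) * f (real k / 2)" by (simp add: assms(2))
  finally show ?thesis using assms(3) by simp
qed

text \<open>
  One point of each coset of \<open>k\<int>\<close> decides whether \<open>f\<close> vanishes on the coset; as \<open>t\<close> is nonzero,
  the step works in both directions.
\<close>

lemma quasi_periodic_zero_shift:
  fixes f :: "real \<Rightarrow> complex"
  assumes per: "\<And>x. f (x + real k) = t * f x" and "t \<noteq> 0" and "f x = 0" and "y \<in> multiples k"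
  shows "f (x + y) = 0"
proof -
  have step: "f (z + real k) = 0 \<longleftrightarrow> f z = 0" for z
    using per \<open>t \<noteq> 0\<close> by simp
  have "f (x + real k * of_int j) = 0" for j :: int
  proof (induction j rule: int_induct[where k = 0])
    case base
    then show ?case using assms by simp
  next
    case (step1 j)
    then show ?case using step[of "x + real k * of_int j"] by (simp add: algebra_simps)
  next
    case (step2 j)
    then show ?case using step[of "x + real k * of_int (j - 1)"] by (simp add: algebra_simps)
  qed
  then show ?thesis using assms(4) by (auto simp: multiples_def elim!: Ints_cases)
qed

section \<open>Coefficients\<close>

lemma bounded_in_l_infinity:
  assumes "\<And>n. norm (c n) \<le> B"
  shows "c \<in> lp_space \<infinity>"
proof -
  have "lp_norm \<infinity> c \<le> ennreal B"
    unfolding Lp_norm_def using assms by (auto intro!: esssup_I ennreal_leI)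
  also have "\<dots> < \<infinity>" by simp
  finally show ?thesis by (simp add: lp_space_def)
qed

text \<open>
  The essential supremum with respect to counting measure is an honest supremum, so a vanishing
  \<open>\<ell>\<^sup>\<infinity>\<close> norm forces every coefficient to vanish.
\<close>

lemma stable_shift_series_eq_0:
  assumes "stable_integer_shifts g" "c \<in> lp_space \<infinity>" and zero: "\<And>x. shift_series g c x = 0"
  shows "c n = 0"
proof -
  obtain A where A: "A > 0" "ennreal A * lp_norm \<infinity> c \<le> Lp_norm \<infinity> lborel (shift_series g c)"
    using assms(1,2) unfolding stable_integer_shifts_def by (metis top_greatest infinity_ennreal_def)
  have "Lp_norm \<infinity> lborel (shift_series g c) \<le> 0"
    unfolding Lp_norm_def by (simp add: zero esssup_const)
  then have "lp_norm \<infinity> c = 0"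
    using A by (auto simp: ennreal_eq_0_iff)
  moreover have "AE n in count_space UNIV. ennreal (norm (c n)) \<le> lp_norm \<infinity> c"
    unfolding Lp_norm_def using esssup_AE by simp
  ultimately show ?thesis by (simp add: AE_count_space)
qed

text \<open>
  The quasi-periodic sequence with factor \<open>t\<close> that is \<open>1\<close> at \<open>j\<close> and vanishes off the residue
  class of \<open>j\<close>, for \<open>j < k\<close>.
\<close>

definition residue_coeff :: "nat \<Rightarrow> complex \<Rightarrow> nat \<Rightarrow> int \<Rightarrow> complex" where
  "residue_coeff k t j n = (if n mod int k = int j then t powi (n div int k) else 0)"

text \<open>
  Symmetrization keeps the quasi-periodicity because \<open>t\<close> is its own inverse. It is a sum rather than
  a case distinction on the residue, so for \<open>t = 1\<close> the value at the index \<open>j\<close> itself is \<open>2\<close> if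
  \<open>j = 0\<close> or \<open>j = k/2\<close> and \<open>1\<close> for the other \<open>j < k\<close>; only its being nonzero matters.
\<close>

definition even_coeff :: "nat \<Rightarrow> complex \<Rightarrow> nat \<Rightarrow> int \<Rightarrow> complex" where
  "even_coeff k t j n = residue_coeff k t j n + residue_coeff k t j (- n)"

lemma residue_coeff_shift:
  assumes "k \<ge> 1" "t \<noteq> 0"
  shows "residue_coeff k t j (n + int k) = t * residue_coeff k t j n"
  using assms by (simp add: residue_coeff_def power_int_add)

lemma even_coeff_reflect: "even_coeff k t j (- n) = even_coeff k t j n"
  by (simp add: even_coeff_def)

lemma even_coeff_shift:
  assumes "k \<ge> 1" "t * t = 1"
  shows "even_coeff k t j (n + int k) = t * even_coeff k t j n"
proof -
  have "t \<noteq> 0" using assms by auto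
  have "residue_coeff k t j (- n) = t * residue_coeff k t j (- (n + int k))"
    using residue_coeff_shift[OF assms(1) \<open>t \<noteq> 0\<close>, of j "- (n + int k)"] by simp
  then have "t * residue_coeff k t j (- n) = (t * t) * residue_coeff k t j (- (n + int k))"
    by (simp only: mult.assoc)
  then show ?thesis
    using residue_coeff_shift[OF assms(1) \<open>t \<noteq> 0\<close>] assms(2)
    by (simp add: even_coeff_def algebra_simps)
qed

lemma norm_even_coeff_le:
  assumes "t * t = 1"
  shows "norm (even_coeff k t j n) \<le> 2"
proof -
  have "norm t * norm t = 1" using assms by (metis norm_mult norm_one)
  then have "norm t = 1"
    by (metis abs_norm_cancel power2_eq_1_iff power2_eq_square abs_one abs_minus_cancel)
  then have bound: "norm (residue_coeff k t j n) \<le> 1" for n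
    by (simp add: residue_coeff_def norm_power_int)
  show ?thesis
    unfolding even_coeff_def using norm_triangle_mono[OF bound bound] by simp
qed

text \<open>
  On \<open>{0..k div 2}\<close> the sequences \<^const>\<open>even_coeff\<close> behave like unit vectors, which makes them
  linearly independent. The reflected index \<open>- i\<close> has residue \<open>k - i\<close>, which meets
  \<open>{0..k div 2}\<close> only for \<open>i = k/2\<close>; there the two summands are \<open>1\<close> and \<open>1 / t\<close>, and would cancel if
  \<open>t = -1\<close>. This is where \<open>t = 1\<close> is needed for even \<open>k\<close>.
\<close>

lemma even_coeff_fundamental:
  assumes "k \<ge> 1" "even k \<longrightarrow> t = 1" "i \<le> k div 2" "j \<le> k div 2"
  shows "even_coeff k t j (int i) = 0 \<longleftrightarrow> i \<noteq> j"
proof (cases "i = 0")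
  case True
  then show ?thesis by (simp add: even_coeff_def residue_coeff_def)
next
  case False
  have "i < k" using assms False by linarith
  have modp: "int i mod int k = int i" and divp: "int i div int k = 0"
    using \<open>i < k\<close> by auto
  have neg: "- int i = int k * (-1) + (int k - int i)" by simp
  have modn: "(- int i) mod int k = int k - int i"
    using \<open>i < k\<close> False by (intro int_mod_pos_eq[OF neg]) auto
  have divn: "(- int i) div int k = -1"
    using \<open>i < k\<close> False by (intro int_div_pos_eq[OF neg]) auto
  show ?thesis
  proof (cases "i + j = k")
    case True
    then have "i = j" "even k" using assms(3,4) by presburger+
    then show ?thesis
      using assms True by (simp add: even_coeff_def residue_coeff_def modp divp modn divn)
  next
    case False
    then have "int k - int i \<noteq> int j" by linarith
    then show ?thesis
      unfolding even_coeff_def residue_coeff_def modp divp modn divn by auto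
  qed
qed

section \<open>Failure of uniqueness\<close>

text \<open>
  The \<open>k div 2 + 1\<close> free coefficients outnumber the \<open>k div 2\<close> prescribed zeros, so a nontrivial
  combination of the \<^const>\<open>even_coeff\<close> sequences meets all conditions.
\<close>

lemma symmetric_shift_series_with_zeros:
  fixes g :: "real \<Rightarrow> complex" and x :: "nat \<Rightarrow> real"
  assumes g: "g \<in> W0" "stable_integer_shifts g" and par: "\<And>x. g (- x) = s * g x"
    and k: "k \<ge> 1" and t: "t = 1 \<or> (t = -1 \<and> odd k)"
  obtains f where "f \<in> shift_invariant_space \<infinity> g" "\<exists>y. f y \<noteq> 0"
    "\<And>y. f (y + real k) = t * f y" "\<And>y. f (- y) = s * f y"
    "\<And>i. i \<in> {1..k div 2} \<Longrightarrow> f (x i) = 0"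
proof -
  define m where "m = k div 2"
  define e where "e = even_coeff k t"
  have tt: "t * t = 1" and tk: "even k \<longrightarrow> t = 1" using t by auto
  have bdd: "norm (e j n) \<le> 2" for j n
    using norm_even_coeff_le[OF tt] by (simp add: e_def)
  obtain a where a: "\<exists>j\<in>{..m}. a j \<noteq> 0"
      "\<forall>i\<in>{1..m}. (\<Sum>j\<in>{..m}. a j * shift_series g (e j) (x i)) = 0"
    using underdetermined_homogeneous_system
      [of "{1..m}" "{..m}" "\<lambda>i j. shift_series g (e j) (x i)"] by auto
  define c where "c n = (\<Sum>j\<in>{..m}. a j * e j n)" for n
  define f where "f = shift_series g c"
  have f_eq: "f y = (\<Sum>j\<in>{..m}. a j * shift_series g (e j) y)" for y
    unfolding f_def c_def by (intro shift_series_linear_combination[OF g(1) _ bdd]) auto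
  have "norm (c n) \<le> (\<Sum>j\<in>{..m}. norm (a j) * 2)" for n
    unfolding c_def by (intro sum_norm_le) (simp add: norm_mult bdd mult_left_mono)
  then have c_mem: "c \<in> lp_space \<infinity>" by (rule bounded_in_l_infinity)
  obtain i where i: "i \<le> m" "a i \<noteq> 0" using a(1) by auto
  have "c (int i) = (\<Sum>j\<in>{..m}. if j = i then a i * e i (int i) else 0)"
    unfolding c_def using even_coeff_fundamental[OF k tk] i
    by (intro sum.cong) (auto simp: e_def m_def)
  also have "\<dots> = a i * e i (int i)" using i by simp
  also have "\<dots> \<noteq> 0"
    using i even_coeff_fundamental[OF k tk, of i i] by (simp add: e_def m_def)
  finally have "\<exists>y. f y \<noteq> 0"
    using stable_shift_series_eq_0[OF g(2) c_mem, of "int i"] by (auto simp: f_def)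
  moreover have "f \<in> shift_invariant_space \<infinity> g"
    using c_mem by (simp add: f_def shift_invariant_space_def)
  moreover have "f (y + real k) = t * f y" for y
  proof -
    have "c (n + int k) = t * c n" for n
      by (simp add: c_def e_def even_coeff_shift[OF k tt] sum_distrib_left mult_ac)
    then show ?thesis
      using shift_series_quasi_periodic[of c "int k" t g y] by (simp add: f_def)
  qed
  moreover have "f (- y) = s * f y" for y
    unfolding f_def
    by (intro shift_series_reflect par) (simp add: c_def e_def even_coeff_reflect)
  moreover have "f (x i) = 0" if "i \<in> {1..k div 2}" for i
    using a(2) that by (simp add: f_eq m_def)
  ultimately show ?thesis using that by blast
qed

text \<open>
  The set \<open>Z\<close> collects zeros that the two symmetries alone force on a function; they cost no free
  coefficient and come in addition to the prescribed points.
\<close>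

lemma not_uniqueness_set_symmetric:
  fixes g :: "real \<Rightarrow> complex" and x :: "nat \<Rightarrow> real"
  assumes g: "g \<in> W0" "stable_integer_shifts g" and par: "\<And>x. g (- x) = s * g x"
    and k: "k \<ge> 1" and t: "t = 1 \<or> (t = -1 \<and> odd k)"
    and auto_zeros: "\<And>f y. \<lbrakk>\<And>y. f (y + real k) = t * f y; \<And>y. f (- y) = s * f y; y \<in> Z\<rbrakk>
                       \<Longrightarrow> f y = (0::complex)"
  shows "\<not> uniqueness_set ((F_set (k div 2) x \<union> Z) + multiples k) (shift_invariant_space \<infinity> g)"
proof -
  obtain f where f: "f \<in> shift_invariant_space \<infinity> g" "\<exists>y. f y \<noteq> 0"
    "\<And>y. f (y + real k) = t * f y" "\<And>y. f (- y) = s * f y"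
    "\<And>i. i \<in> {1..k div 2} \<Longrightarrow> f (x i) = 0"
    using symmetric_shift_series_with_zeros[OF g par k t] by metis
  have "f z = 0" if "z \<in> F_set (k div 2) x \<union> Z" for z
    using that f(5) f(4)[of "x _"] auto_zeros[of f, OF f(3,4)] by (auto simp: F_set_def)
  moreover have "t \<noteq> 0" using t by auto
  ultimately have "\<forall>l\<in>(F_set (k div 2) x \<union> Z) + multiples k. f l = 0"
    using quasi_periodic_zero_shift[of f, OF f(3)] by (auto elim!: set_plus_elim)
  then show ?thesis using f(1,2) by (auto simp: uniqueness_set_def)
qed

theorem theorem3p1:
  fixes g :: "real \<Rightarrow> complex" and k :: nat
  assumes "g \<in> W0"
    and "stable_integer_shifts g"
    and "k \<ge> 1"
  shows "((\<forall>x. g (- x) = - g x) \<longrightarrow>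
            (\<forall>x. admissible_points (k div 2) x \<longrightarrow>
               \<not> uniqueness_set (Lambda_set k x) (shift_invariant_space \<infinity> g))) \<and>
         ((\<forall>x. g (- x) = g x) \<longrightarrow>
            (odd k \<longrightarrow>
               (\<forall>x. admissible_points ((k - 1) div 2) x \<longrightarrow>
                  \<not> uniqueness_set (Gamma_set k x) (shift_invariant_space \<infinity> g))) \<and>
            (even k \<longrightarrow>
               (\<forall>x. admissible_points (k div 2) x \<longrightarrow>
                  \<not> uniqueness_set (Theta_set k x) (shift_invariant_space \<infinity> g))))"
proof (intro conjI impI allI)
  fix x assume "\<forall>x. g (- x) = - g x"
  then have par: "g (- y) = - 1 * g y" for y by simp
  have "f y = 0"
    if "\<And>y. f (y + real k) = 1 * f y" "\<And>y. f (- y) = - 1 * f y" "y \<in> {0, real k / 2}"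
    for f :: "real \<Rightarrow> complex" and y
  proof -
    have "f 0 = 0" using that(2)[of 0] by simp
    moreover have "f (real k / 2) = 0" using half_period_zero[OF that(1,2)] by simp
    ultimately show ?thesis using that(3) by blast
  qed
  then show "\<not> uniqueness_set (Lambda_set k x) (shift_invariant_space \<infinity> g)"
    unfolding Lambda_set_def by (intro not_uniqueness_set_symmetric[OF assms(1,2) par assms(3), of 1]) auto
next
  fix x assume "\<forall>x. g (- x) = g x" "odd k"
  then have par: "g (- y) = 1 * g y" for y by simp
  have "f y = 0"
    if "\<And>y. f (y + real k) = - 1 * f y" "\<And>y. f (- y) = 1 * f y" "y \<in> {real k / 2}"
    for f :: "real \<Rightarrow> complex" and y
  proof -
    have "f (real k / 2) = 0" using half_period_zero[OF that(1,2)] by simp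
    then show ?thesis using that(3) by blast
  qed
  moreover have "(k - 1) div 2 = k div 2" using \<open>odd k\<close> by presburger
  ultimately show "\<not> uniqueness_set (Gamma_set k x) (shift_invariant_space \<infinity> g)"
    unfolding Gamma_set_def using \<open>odd k\<close>
    by (simp only:) (intro not_uniqueness_set_symmetric[OF assms(1,2) par assms(3), of "- 1"]; auto)
next
  fix x assume "\<forall>x. g (- x) = g x"
  then have par: "g (- y) = 1 * g y" for y by simp
  show "\<not> uniqueness_set (Theta_set k x) (shift_invariant_space \<infinity> g)"
    using not_uniqueness_set_symmetric[OF assms(1,2) par assms(3), of 1 "{}" x]
    by (simp add: Theta_set_def)
qed

end
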